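(* Let $\zeta:\mathbb{R}^n\to\mathbb{R}^n$ be a smooth invertible function, let $h:\mathbb{R}^n\to\mathbb{R}$ be differentiable, let $\gamma\in\mathbb{R}^n$, $\theta=\zeta(\gamma)$, $\alpha>0$, and let $J_\zeta$ be the Jacobian of $\zeta$ at $\gamma$. Suppose $B_\theta$ and $B_\gamma$ are invertible $n\times n$ matrices satisfying $$J_\zeta^\top B_\theta J_\zeta = B_\gamma .$$ Put $d_\theta=-\alpha B_\theta^{-1}\nabla h(\theta)$ and $d_\gamma=-\alpha B_\gamma^{-1}\nabla_\gamma h$, where $\nabla_\gamma h$ is the gradient at $\gamma$ of $\gamma\mapsto h(\zeta(\gamma))$. Then additively updating $\theta$ by $d_\theta$ is approximately equivalent to additively updating $\gamma$ by $d_\gamma$, in the sense that $$\|\zeta(\gamma+d_\gamma)-(\theta+d_\theta)\|\le\|\zeta(\gamma+d_\gamma)-(\zeta(\gamma)+J_\zeta d_\gamma)\| .$$ Moreover, the right-hand side can be further bounded: there are $c_1,\dots,c_n\in(0,1)$ such that $$\|\zeta(\gamma+d_\gamma)-(\zeta(\gamma)+J_\zeta d_\gamma)\|\le\frac12\left\|\begin{bmatrix} d_\gamma^\top H_{[\zeta]_1}(\gamma+c_1d_\gamma)d_\gamma\\ \vdots\\ d_\gamma^\top H_{[\zeta]_n}(\gamma+c_nd_\gamma)d_\gamma\end{bmatrix}\right\| ,$$ and it is exactly $0$ if $\zeta$ is affine. If in addition there is a $C\ge 0$ such that $\|H_{[\zeta]_i}(\gamma')\|_2\le C$ for all $i$ and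 all $\gamma'\in\mathbb{R}^n$, then (with $\|\cdot\|$ the Euclidean norm) the error $\|\zeta(\gamma+d_\gamma)-(\theta+d_\theta)\|$ is at most $\frac12 C\sqrt n\,\|d_\gamma\|^2$.
   Context: $H_{[\zeta]_i}(\cdot)$ denotes the Hessian of the $i$-th component function of $\zeta$. $\|\cdot\|$ is a norm on $\mathbb{R}^n$ (arbitrary except in the last bound, where it is Euclidean), and $\|\cdot\|_2$ on matrices is the spectral norm. *)

theory Defs
  imports "HOL-Analysis.Analysis"
begin

definition is_norm :: "('a::real_vector \<Rightarrow> real) \<Rightarrow> bool" where
  "is_norm N \<longleftrightarrow>
     (\<forall>x. N x = 0 \<longleftrightarrow> x = 0) \<and>
     (\<forall>a x. N (a *\<^sub>R x) = \<bar>a\<bar> * N x) \<and>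
     (\<forall>x y. N (x + y) \<le> N x + N y)"

text \<open>
  On a finite-dimensional domain, requiring every directional derivative to be of
  class \<open>C\<^sup>k\<close> is the same as requiring the total derivative to be of class \<open>C\<^sup>k\<close>.
\<close>

primrec C_k :: "nat \<Rightarrow> ('a::euclidean_space \<Rightarrow> 'b::real_normed_vector) \<Rightarrow> bool" where
  "C_k 0 f \<longleftrightarrow> continuous_on UNIV f"
| "C_k (Suc k) f \<longleftrightarrow>
     f differentiable_on UNIV \<and> (\<forall>v. C_k k (\<lambda>x. frechet_derivative f (at x) v))"

definition smooth :: "('a::euclidean_space \<Rightarrow> 'b::real_normed_vector) \<Rightarrow> bool" where
  "smooth f \<longleftrightarrow> (\<forall>k. C_k k f)"

definition gradient :: "('a::real_inner \<Rightarrow> real) \<Rightarrow> 'a \<Rightarrow> 'a" where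
  "gradient f x = (THE D. GDERIV f x :> D)"

lemma gradient_eq:
  assumes "GDERIV f x :> D"
  shows "gradient f x = D"
  unfolding gradient_def
proof (rule the_equality)
  fix E assume "GDERIV f x :> E"
  then have "(\<lambda>h. h \<bullet> E) = (\<lambda>h. h \<bullet> D)"
    using assms unfolding gderiv_def by (rule has_derivative_unique)
  then show "E = D"
    by (simp add: fun_eq_iff vector_eq_ldot)
qed (rule assms)

definition hessian :: "(real ^ 'n \<Rightarrow> real) \<Rightarrow> real ^ 'n \<Rightarrow> real ^ 'n ^ 'n" where
  "hessian f x = jacobian (gradient f) (at x)"

definition spectral_norm :: "real ^ 'n ^ 'm \<Rightarrow> real" where
  "spectral_norm A = onorm ((*v) A)"

end

theory Submission
  imports Defs
begin

text \<open>
  By the chain rule the gradient of \<open>h \<circ> \<zeta>\<close> at \<open>\<gamma>\<close> is \<open>J\<^sup>T g\<close> with \<open>g = \<nabla>h(\<theta>)\<close>, and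
  invertibility of \<open>B\<^sub>\<gamma> = J\<^sup>T B\<^sub>\<theta> J\<close> forces \<open>J\<close> to be invertible. Hence
  \<open>J B\<^sub>\<gamma>\<^sup>-\<^sup>1 J\<^sup>T = B\<^sub>\<theta>\<^sup>-\<^sup>1\<close>, so \<open>J d\<^sub>\<gamma> = d\<^sub>\<theta>\<close> and the first inequality is an equality. The remaining
  claims follow from the second-order Taylor formula with Lagrange remainder, applied to each
  component of \<open>\<zeta>\<close> along the segment from \<open>\<gamma>\<close> to \<open>\<gamma> + d\<^sub>\<gamma>\<close>; this too is an equality of vectors.
\<close>

text \<open>\<open>gradient\<close> is a definite description, so it can be used only once a
  representing vector is exhibited. In finite dimension the values of the derivative on the basis
  are the coordinates of such a vector.\<close>

lemma differentiable_imp_GDERIV: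
  fixes f :: "'a::euclidean_space \<Rightarrow> real"
  assumes "f differentiable (at x)"
  shows "GDERIV f x :> gradient f x"
proof -
  let ?D = "\<Sum>b\<in>Basis. frechet_derivative f (at x) b *\<^sub>R b"
  have f': "(f has_derivative frechet_derivative f (at x)) (at x)"
    using assms by (simp add: frechet_derivative_works)
  then interpret f': linear "frechet_derivative f (at x)"
    by (rule has_derivative_linear)
  have "frechet_derivative f (at x) = (\<lambda>v. v \<bullet> ?D)"
  proof
    fix v
    have "frechet_derivative f (at x) v
        = frechet_derivative f (at x) (\<Sum>b\<in>Basis. (v \<bullet> b) *\<^sub>R b)"
      by (simp add: euclidean_representation)
    then show "frechet_derivative f (at x) v = v \<bullet> ?D"
      by (simp add: f'.sum f'.scale inner_sum_right mult.commute)
  qed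
  then have "GDERIV f x :> ?D"
    using f' by (simp add: gderiv_def)
  then show ?thesis
    using gradient_eq by metis
qed

text \<open>This is Maclaurin's formula of order 2 on [0, 1] for the restriction of \<open>f\<close>
  to the segment, t \<mapsto> f (x + t d), whose first two derivatives come from the chain
  rule.\<close>

lemma taylor2_gradient:
  fixes f :: "real ^ 'n \<Rightarrow> real"
  assumes f: "\<And>x. f differentiable (at x)"
    and g: "\<And>x. gradient f differentiable (at x)"
  obtains c where "0 < c" "c < 1"
    "f (x + d) = f x + d \<bullet> gradient f x + d \<bullet> (hessian f (x + c *\<^sub>R d) *v d) / 2"
proof -
  \<comment> \<open>\<open>Maclaurin\<close> expects a family of derivatives indexed by all
    naturals. The last branch is the second derivative; its values for m > 2 are mere
    defaults.\<close>
  define diff where "diff m t = (if m = 0 then f (x + t *\<^sub>R d)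
      else if m = 1 then d \<bullet> gradient f (x + t *\<^sub>R d)
      else d \<bullet> (hessian f (x + t *\<^sub>R d) *v d))" for m :: nat and t :: real
  have line: "((\<lambda>t. x + t *\<^sub>R d) has_derivative (\<lambda>s. s *\<^sub>R d)) (at t)" for t
    by (auto intro!: derivative_eq_intros)
  have f': "(f has_derivative (\<lambda>v. v \<bullet> gradient f y)) (at y)" for y
    using differentiable_imp_GDERIV [OF f] by (simp add: gderiv_def)
  have g': "(gradient f has_derivative (\<lambda>v. hessian f y *v v)) (at y)" for y
    using g by (simp add: hessian_def jacobian_works)
  have "((\<lambda>t. f (x + t *\<^sub>R d)) has_real_derivative d \<bullet> gradient f (x + t *\<^sub>R d)) (at t)" for t
    using has_derivative_compose [OF line f']
    by (simp add: has_field_derivative_def mult_commute_abs)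
  moreover have "((\<lambda>t. d \<bullet> gradient f (x + t *\<^sub>R d)) has_real_derivative
      d \<bullet> (hessian f (x + t *\<^sub>R d) *v d)) (at t)" for t
    using has_derivative_inner_right [OF has_derivative_compose [OF line g'], of d]
    by (simp add: has_field_derivative_def mult_commute_abs matrix_vector_mult_scaleR)
  ultimately have "\<forall>m t. m < 2 \<and> 0 \<le> t \<and> t \<le> 1 \<longrightarrow>
      (diff m has_real_derivative diff (Suc m) t) (at t)"
    unfolding diff_def by (auto simp: less_2_cases_iff)
  then obtain t where "0 < t" "t < 1"
      "diff 0 1 = (\<Sum>m<2. diff m 0 / fact m * 1 ^ m) + diff 2 t / fact 2 * 1 ^ 2"
    using Maclaurin [of 1 2 diff "diff 0"] by auto
  then show thesis
    by (intro that [of t]) (simp_all add: diff_def numeral_2_eq_2)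
qed

text \<open>This is the bridge from \<open>C_k\<close>, phrased by directional derivatives of the
  vector-valued map, to \<open>gradient\<close> and \<open>hessian\<close> of its components: the
  coordinates of a component's gradient are components of directional derivatives along the
  basis.\<close>

lemma
  fixes \<zeta> :: "real ^ 'n \<Rightarrow> real ^ 'm"
  assumes "C_k 2 \<zeta>"
  shows C_k_2_component_differentiable: "(\<lambda>x. \<zeta> x $ i) differentiable (at x)"
    and C_k_2_component_gradient_differentiable: "gradient (\<lambda>x. \<zeta> x $ i) differentiable (at x)"
proof -
  let ?D = "\<lambda>x. frechet_derivative \<zeta> (at x)"
  have \<zeta>: "\<zeta> differentiable (at x)" for x
    using assms by (simp add: numeral_2_eq_2 differentiable_on_def)
  have \<zeta>'_differentiable: "(\<lambda>x. ?D x v) differentiable (at x)" for v x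
    using assms by (simp add: numeral_2_eq_2 differentiable_on_def)
  have \<zeta>': "((\<lambda>x. \<zeta> x $ i) has_derivative (\<lambda>v. ?D x v $ i)) (at x)" for x
    using \<zeta> by (intro bounded_linear.has_derivative [OF bounded_linear_vec_nth])
      (simp add: frechet_derivative_works)
  then show diff: "(\<lambda>x. \<zeta> x $ i) differentiable (at x)" for x
    by (auto simp: differentiable_def)
  have grad: "gradient (\<lambda>x. \<zeta> x $ i) x = (\<Sum>b\<in>Basis. (?D x b $ i) *\<^sub>R b)" for x
  proof -
    have "(\<lambda>v. v \<bullet> gradient (\<lambda>x. \<zeta> x $ i) x) = (\<lambda>v. ?D x v $ i)"
      using differentiable_imp_GDERIV [OF diff] \<zeta>'
      unfolding gderiv_def by (rule has_derivative_unique)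
    then have "gradient (\<lambda>x. \<zeta> x $ i) x \<bullet> b = ?D x b $ i" for b
      by (metis inner_commute)
    then show ?thesis
      by (metis (no_types, lifting) euclidean_representation sum.cong)
  qed
  have "(\<lambda>x. ?D x b $ i) differentiable (at x)" for b
    using \<zeta>'_differentiable [of b x] bounded_linear.has_derivative [OF bounded_linear_vec_nth]
    unfolding differentiable_def by blast
  \<comment> \<open>The formula \<open>grad\<close> holds at every point, so the gradient can be
    replaced as a function by a finite sum of differentiable terms.\<close>
  then show "gradient (\<lambda>x. \<zeta> x $ i) differentiable (at x)"
    by (subst ext [OF grad]) (intro differentiable_sum differentiable_scaleR ballI finite_Basis differentiable_const)
qed

lemma
  fixes A :: "'a::semiring_1 ^ 'n ^ 'm"
  assumes "invertible A"
  shows matrix_inv_right: "A ** matrix_inv A = mat 1"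
    and matrix_inv_left: "matrix_inv A ** A = mat 1"
  using someI_ex [OF assms [unfolded invertible_def]] by (auto simp: matrix_inv_def)

text \<open>With C = J^T B J and w = J C^-1 J^T g one has J^T B w = C C^-1 J^T g = J^T g. Cancelling
  J^T leaves B w = g.\<close>

lemma matrix_inv_mul_vec_congruence:
  fixes J B :: "real ^ 'n ^ 'n"
  assumes B: "invertible B" and JBJ: "invertible (transpose J ** B ** J)"
  shows "J *v (matrix_inv (transpose J ** B ** J) *v (transpose J *v g)) = matrix_inv B *v g"
proof -
  let ?C = "transpose J ** B ** J"
  \<comment> \<open>The determinant of the product is det J * det B * det J, so det J cannot
    vanish.\<close>
  have "invertible J"
    using JBJ by (simp add: invertible_det_nz det_mul)
  then have "inj ((*v) (transpose J))"
    by (intro inj_matrix_vector_mult) (simp add: invertible_det_nz)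
  moreover have "transpose J *v (B *v (J *v (matrix_inv ?C *v (transpose J *v g)))) = transpose J *v g"
    using JBJ by (simp add: matrix_vector_mul_assoc matrix_mul_assoc matrix_inv_right)
  ultimately have "B *v (J *v (matrix_inv ?C *v (transpose J *v g))) = g"
    by (rule injD)
  then show ?thesis
    using B by (metis matrix_inv_left matrix_vector_mul_assoc matrix_vector_mul_lid)
qed

text \<open>The chain rule gives the derivative v \<mapsto> (J v) \<bullet> \<nabla>h; moving
  \<open>J\<close> to the other side of the inner product produces the transpose.\<close>

lemma gradient_compose:
  fixes \<zeta> :: "real ^ 'n \<Rightarrow> real ^ 'm" and h :: "real ^ 'm \<Rightarrow> real"
  assumes \<zeta>: "\<zeta> differentiable (at x)" and h: "h differentiable (at (\<zeta> x))"
  shows "gradient (\<lambda>x. h (\<zeta> x)) x = transpose (jacobian \<zeta> (at x)) *v gradient h (\<zeta> x)"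
proof (rule gradient_eq)
  have h': "(h has_derivative (\<lambda>v. v \<bullet> gradient h (\<zeta> x))) (at (\<zeta> x))"
    using differentiable_imp_GDERIV [OF h] by (simp add: gderiv_def)
  have \<zeta>': "(\<zeta> has_derivative (\<lambda>v. jacobian \<zeta> (at x) *v v)) (at x)"
    using \<zeta> by (simp add: jacobian_works)
  have "(jacobian \<zeta> (at x) *v v) \<bullet> gradient h (\<zeta> x)
      = v \<bullet> (transpose (jacobian \<zeta> (at x)) *v gradient h (\<zeta> x))" for v
    by (metis dot_lmul_matrix inner_commute transpose_matrix_vector)
  then show "GDERIV (\<lambda>x. h (\<zeta> x)) x :> transpose (jacobian \<zeta> (at x)) *v gradient h (\<zeta> x)"
    using has_derivative_compose [OF \<zeta>' h'] by (simp only: gderiv_def)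
qed

lemma abs_inner_mul_vec_le_spectral_norm:
  fixes A :: "real ^ 'n ^ 'n"
  shows "\<bar>x \<bullet> (A *v x)\<bar> \<le> spectral_norm A * (norm x)\<^sup>2"
proof -
  have "\<bar>x \<bullet> (A *v x)\<bar> \<le> norm x * norm (A *v x)"
    by (rule Cauchy_Schwarz_ineq2)
  also have "\<dots> \<le> norm x * (spectral_norm A * norm x)"
    unfolding spectral_norm_def by (intro mult_left_mono onorm) auto
  finally show ?thesis
    by (simp add: power2_eq_square mult_ac)
qed

lemma norm_vec_le_sqrt_CARD:
  fixes v :: "real ^ 'n"
  assumes "\<And>i. \<bar>v $ i\<bar> \<le> M"
  shows "norm v \<le> sqrt (real CARD('n)) * M"
proof -
  \<comment> \<open>Index types are nonempty, so some entry forces this; it is what makes the root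
    of M^2 equal to \<open>M\<close> below.\<close>
  have "0 \<le> M"
    using assms abs_ge_zero order_trans by blast
  have "norm v = sqrt (\<Sum>i\<in>UNIV. \<bar>v $ i\<bar>\<^sup>2)"
    by (simp add: norm_vec_def L2_set_def)
  also have "\<dots> \<le> sqrt (\<Sum>i\<in>(UNIV :: 'n set). M\<^sup>2)"
    by (intro real_sqrt_le_mono sum_mono power_mono assms) auto
  also have "\<dots> = sqrt (real CARD('n)) * M"
    using \<open>0 \<le> M\<close> by (simp add: real_sqrt_mult)
  finally show ?thesis .
qed

theorem theorem1:
  fixes \<zeta> :: "real ^ 'n \<Rightarrow> real ^ 'n"
    and h :: "real ^ 'n \<Rightarrow> real"
    and \<gamma> \<theta> d\<^sub>\<theta> d\<^sub>\<gamma> :: "real ^ 'n"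
    and J B\<^sub>\<theta> B\<^sub>\<gamma> :: "real ^ 'n ^ 'n"
    and \<alpha> :: real
    and N :: "real ^ 'n \<Rightarrow> real"
  assumes "smooth \<zeta>" and "bij \<zeta>"
    and "h differentiable_on UNIV"
    and "\<theta> = \<zeta> \<gamma>"
    and "\<alpha> > 0"
    and "J = jacobian \<zeta> (at \<gamma>)"
    and "invertible B\<^sub>\<theta>" and "invertible B\<^sub>\<gamma>"
    and "transpose J ** B\<^sub>\<theta> ** J = B\<^sub>\<gamma>"
    and "d\<^sub>\<theta> = - \<alpha> *\<^sub>R (matrix_inv B\<^sub>\<theta> *v gradient h \<theta>)"
    and "d\<^sub>\<gamma> = - \<alpha> *\<^sub>R (matrix_inv B\<^sub>\<gamma> *v gradient (\<lambda>x. h (\<zeta> x)) \<gamma>)"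
    and "is_norm N"
  shows "N (\<zeta> (\<gamma> + d\<^sub>\<gamma>) - (\<theta> + d\<^sub>\<theta>)) \<le> N (\<zeta> (\<gamma> + d\<^sub>\<gamma>) - (\<zeta> \<gamma> + J *v d\<^sub>\<gamma>))
    \<and> (\<exists>c :: 'n \<Rightarrow> real. (\<forall>i. 0 < c i \<and> c i < 1) \<and>
        N (\<zeta> (\<gamma> + d\<^sub>\<gamma>) - (\<zeta> \<gamma> + J *v d\<^sub>\<gamma>))
          \<le> 1 / 2 * N (\<chi> i. d\<^sub>\<gamma> \<bullet> (hessian (\<lambda>x. \<zeta> x $ i) (\<gamma> + c i *\<^sub>R d\<^sub>\<gamma>) *v d\<^sub>\<gamma>)))
    \<and> ((\<exists>A b. \<forall>x. \<zeta> x = A *v x + b) \<longrightarrow> N (\<zeta> (\<gamma> + d\<^sub>\<gamma>) - (\<zeta> \<gamma> + J *v d\<^sub>\<gamma>)) = 0)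
    \<and> (\<forall>C \<ge> 0. (\<forall>i \<gamma>'. spectral_norm (hessian (\<lambda>x. \<zeta> x $ i) \<gamma>') \<le> C) \<longrightarrow>
        norm (\<zeta> (\<gamma> + d\<^sub>\<gamma>) - (\<theta> + d\<^sub>\<theta>)) \<le> 1 / 2 * C * sqrt (real CARD('n)) * (norm d\<^sub>\<gamma>)\<^sup>2)"
proof -
  have C2: "C_k 2 \<zeta>"
    using \<open>smooth \<zeta>\<close> by (simp add: smooth_def)
  have \<zeta>: "\<zeta> differentiable (at x)" for x
    using C2 by (simp add: numeral_2_eq_2 differentiable_on_def)
  then have \<zeta>': "(\<zeta> has_derivative (\<lambda>v. J *v v)) (at \<gamma>)"
    using \<open>J = jacobian \<zeta> (at \<gamma>)\<close> by (simp add: jacobian_works)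
  have "gradient (\<lambda>x. h (\<zeta> x)) \<gamma> = transpose J *v gradient h \<theta>"
    using gradient_compose [OF \<zeta>, of h \<gamma>] assms(3,4,6) by (simp add: differentiable_on_def)
  then have "J *v d\<^sub>\<gamma> = - \<alpha> *\<^sub>R (J *v (matrix_inv B\<^sub>\<gamma> *v (transpose J *v gradient h \<theta>)))"
    using assms(11) by (simp add: matrix_vector_mult_scaleR linear_neg)
  also have "\<dots> = d\<^sub>\<theta>"
    using matrix_inv_mul_vec_congruence [of B\<^sub>\<theta> J] assms(7-10) by simp
  finally have Jd: "J *v d\<^sub>\<gamma> = d\<^sub>\<theta>" .
  have "\<exists>c. 0 < c \<and> c < 1 \<and> (\<zeta> (\<gamma> + d\<^sub>\<gamma>) - (\<zeta> \<gamma> + J *v d\<^sub>\<gamma>)) $ i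
      = d\<^sub>\<gamma> \<bullet> (hessian (\<lambda>x. \<zeta> x $ i) (\<gamma> + c *\<^sub>R d\<^sub>\<gamma>) *v d\<^sub>\<gamma>) / 2" for i
  proof -
    have "GDERIV (\<lambda>x. \<zeta> x $ i) \<gamma> :> gradient (\<lambda>x. \<zeta> x $ i) \<gamma>"
      using C2 by (intro differentiable_imp_GDERIV C_k_2_component_differentiable)
    moreover have "((\<lambda>x. \<zeta> x $ i) has_derivative (\<lambda>v. (J *v v) $ i)) (at \<gamma>)"
      by (rule bounded_linear.has_derivative [OF bounded_linear_vec_nth \<zeta>'])
    \<comment> \<open>The linear Taylor term of component i must be matched with row i of
      \<open>J\<close>; both represent the derivative of that component at \<gamma>, which is
      unique.\<close>
    ultimately have "(\<lambda>v. v \<bullet> gradient (\<lambda>x. \<zeta> x $ i) \<gamma>) = (\<lambda>v. (J *v v) $ i)"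
      unfolding gderiv_def by (rule has_derivative_unique)
    then have "d\<^sub>\<gamma> \<bullet> gradient (\<lambda>x. \<zeta> x $ i) \<gamma> = (J *v d\<^sub>\<gamma>) $ i"
      by metis
    moreover obtain c where "0 < c" "c < 1" "\<zeta> (\<gamma> + d\<^sub>\<gamma>) $ i = \<zeta> \<gamma> $ i
        + d\<^sub>\<gamma> \<bullet> gradient (\<lambda>x. \<zeta> x $ i) \<gamma>
        + d\<^sub>\<gamma> \<bullet> (hessian (\<lambda>x. \<zeta> x $ i) (\<gamma> + c *\<^sub>R d\<^sub>\<gamma>) *v d\<^sub>\<gamma>) / 2"
      using taylor2_gradient [of "\<lambda>x. \<zeta> x $ i" \<gamma> d\<^sub>\<gamma>, OF
          C_k_2_component_differentiable [OF C2] C_k_2_component_gradient_differentiable [OF C2]]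
      by blast
    ultimately show ?thesis
      by auto
  qed
  \<comment> \<open>Each component has its own intermediate point; choice over i collects them in
    one function \<open>c\<close>.\<close>
  then obtain c where c: "\<And>i. 0 < c i \<and> c i < 1"
    and err: "\<And>i. (\<zeta> (\<gamma> + d\<^sub>\<gamma>) - (\<zeta> \<gamma> + J *v d\<^sub>\<gamma>)) $ i
      = d\<^sub>\<gamma> \<bullet> (hessian (\<lambda>x. \<zeta> x $ i) (\<gamma> + c i *\<^sub>R d\<^sub>\<gamma>) *v d\<^sub>\<gamma>) / 2"
    by metis
  have "\<zeta> (\<gamma> + d\<^sub>\<gamma>) - (\<zeta> \<gamma> + J *v d\<^sub>\<gamma>)
      = (1 / 2) *\<^sub>R (\<chi> i. d\<^sub>\<gamma> \<bullet> (hessian (\<lambda>x. \<zeta> x $ i) (\<gamma> + c i *\<^sub>R d\<^sub>\<gamma>) *v d\<^sub>\<gamma>))"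
    unfolding vec_eq_iff err by simp
  then have taylor: "N (\<zeta> (\<gamma> + d\<^sub>\<gamma>) - (\<zeta> \<gamma> + J *v d\<^sub>\<gamma>))
      = 1 / 2 * N (\<chi> i. d\<^sub>\<gamma> \<bullet> (hessian (\<lambda>x. \<zeta> x $ i) (\<gamma> + c i *\<^sub>R d\<^sub>\<gamma>) *v d\<^sub>\<gamma>))"
    using \<open>is_norm N\<close> by (simp add: is_norm_def)
  have affine: "N (\<zeta> (\<gamma> + d\<^sub>\<gamma>) - (\<zeta> \<gamma> + J *v d\<^sub>\<gamma>)) = 0" if "\<And>x. \<zeta> x = A *v x + b" for A b
  proof -
    have "(\<zeta> has_derivative (\<lambda>v. A *v v)) (at \<gamma>)"
      unfolding ext [OF that]
      by (auto intro!: derivative_eq_intros bounded_linear_imp_has_derivative)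
    \<comment> \<open>An affine map has its linear part as derivative, so \<open>A\<close> acts as
      \<open>J\<close> and the linearization at \<gamma> is exact.\<close>
    then have "(\<lambda>v. A *v v) = (\<lambda>v. J *v v)"
      using \<zeta>' by (rule has_derivative_unique)
    then have "J *v d\<^sub>\<gamma> = A *v d\<^sub>\<gamma>"
      by metis
    then show ?thesis
      using \<open>is_norm N\<close> by (simp add: that is_norm_def matrix_vector_right_distrib)
  qed
  have bound: "norm (\<zeta> (\<gamma> + d\<^sub>\<gamma>) - (\<theta> + d\<^sub>\<theta>)) \<le> 1 / 2 * C * sqrt (real CARD('n)) * (norm d\<^sub>\<gamma>)\<^sup>2"
    if C: "\<And>i \<gamma>'. spectral_norm (hessian (\<lambda>x. \<zeta> x $ i) \<gamma>') \<le> C" for C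
  proof -
    \<comment> \<open>The Hessian bound is used at the intermediate points given by
      \<open>c\<close>. A uniform bound on the entries then costs a factor sqrt n in the Euclidean
      norm.\<close>
    have "\<bar>(\<zeta> (\<gamma> + d\<^sub>\<gamma>) - (\<zeta> \<gamma> + J *v d\<^sub>\<gamma>)) $ i\<bar> \<le> C * (norm d\<^sub>\<gamma>)\<^sup>2 / 2" for i
    proof -
      have "\<bar>d\<^sub>\<gamma> \<bullet> (hessian (\<lambda>x. \<zeta> x $ i) (\<gamma> + c i *\<^sub>R d\<^sub>\<gamma>) *v d\<^sub>\<gamma>)\<bar> \<le> C * (norm d\<^sub>\<gamma>)\<^sup>2"
        by (rule order_trans [OF abs_inner_mul_vec_le_spectral_norm]) (intro mult_right_mono C; simp)
      then show ?thesis
        unfolding err by simp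
    qed
    from norm_vec_le_sqrt_CARD [OF this] show ?thesis
      using Jd assms(4) by (simp add: mult_ac)
  qed
  show ?thesis
  proof (intro conjI impI allI)
    show "\<exists>c. (\<forall>i. 0 < c i \<and> c i < 1) \<and> N (\<zeta> (\<gamma> + d\<^sub>\<gamma>) - (\<zeta> \<gamma> + J *v d\<^sub>\<gamma>))
        \<le> 1 / 2 * N (\<chi> i. d\<^sub>\<gamma> \<bullet> (hessian (\<lambda>x. \<zeta> x $ i) (\<gamma> + c i *\<^sub>R d\<^sub>\<gamma>) *v d\<^sub>\<gamma>))"
      using c taylor by (intro exI [of _ c]) simp
  qed (use Jd assms(4) affine bound in auto)
qed

end
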